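(* For every constant $c\ge 0$ there is a constant $C$ such that for every access sequence $X=(x_1,\dots,x_m)$ with no repeated key values, if $G_X$ contains at most $c$ z-rectangles, then $\mathsf{IRB}_{\uparrow}(X)\le C\,m$.
   Context: $G_X=\{(x_i,i): i\in[m]\}$; for a point $p$, $p.x,p.y$ are its coordinates. For a point set $P$, a z-rectangle of $P$ is a tuple $(p,q,r,s)\in P^4$ with $q.x<p.x<r.x<s.x$, $r.y<q.y<s.y<p.y$, and $P\cap([q.x,s.x]\times[r.y,p.y])=\{p,q,r,s\}$. For points $p,q$, $\mathrm{rect}(p,q)$ is the smallest closed axis-aligned rectangle containing both. $\mathsf{IRB}_{\uparrow}$: sweep a horizontal line upward over the points of $P=G_X$ in increasing $y$-coordinate, maintaining a set $Q$ which initially is $P$. When the sweep reaches the point $p\in P$, for every point $q$ of $Q$ (as it stands when $p$ is reached, i.e. $P$ together with all points added at earlier sweep positions) with $q.x<p.x$, $q.y<p.y$ and $Q\cap\mathrm{rect}(p,q)=\{p,q\}$, add the upper-left corner $(q.x,p.y)$ of $\mathrm{rect}(p,q)$ to $Q$. Let $\mathrm{add}_{\uparrow}(P)$ be the set of all added points (excluding those originally in $P$) and $\mathsf{IRB}_{\uparrow}(X)=|\mathrm{add}_{\uparrow}(G_X)|$. *)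

theory Defs
  imports Complex_Main
begin

type_synonym point = "real \<times> real"

text \<open>The list entry \<open>X ! i\<close> is the key \<open>x\<^sub>i\<^sub>+\<^sub>1\<close>, accessed at time \<open>i + 1\<close>.\<close>

definition G :: "real list \<Rightarrow> point set" where
  "G X = {(X ! i, real (i + 1)) | i. i < length X}"

definition z_rectangle :: "point set \<Rightarrow> point \<Rightarrow> point \<Rightarrow> point \<Rightarrow> point \<Rightarrow> bool" where
  "z_rectangle P p q r s \<longleftrightarrow>
     p \<in> P \<and> q \<in> P \<and> r \<in> P \<and> s \<in> P \<and>
     fst q < fst p \<and> fst p < fst r \<and> fst r < fst s \<and>
     snd r < snd q \<and> snd q < snd s \<and> snd s < snd p \<and>
     P \<inter> ({fst q..fst s} \<times> {snd r..snd p}) = {p, q, r, s}"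

definition z_rectangles :: "point set \<Rightarrow> (point \<times> point \<times> point \<times> point) set" where
  "z_rectangles P = {(p, q, r, s). z_rectangle P p q r s}"

definition rect :: "point \<Rightarrow> point \<Rightarrow> point set" where
  "rect p q = {min (fst p) (fst q)..max (fst p) (fst q)} \<times>
              {min (snd p) (snd q)..max (snd p) (snd q)}"

definition corners_up :: "point set \<Rightarrow> point \<Rightarrow> point set" where
  "corners_up Q p =
     {(fst q, snd p) | q. q \<in> Q \<and> fst q < fst p \<and> snd q < snd p \<and> Q \<inter> rect p q = {p, q}}"

text \<open>One position \<open>y\<close> of the sweep line. The union over \<open>p\<close> has a single member when the
  points of \<open>P\<close> have distinct \<open>y\<close>-coordinates, as is the case for \<open>P = G X\<close>. All corners for
  \<open>p\<close> are computed from the same \<open>Q\<close>, the one present when \<open>p\<close> is reached.\<close>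

definition sweep_up_at :: "point set \<Rightarrow> real \<Rightarrow> point set \<Rightarrow> point set" where
  "sweep_up_at P y Q = Q \<union> (\<Union>p \<in> {p \<in> P. snd p = y}. corners_up Q p)"

definition sweep_up :: "point set \<Rightarrow> point set" where
  "sweep_up P = fold (sweep_up_at P) (sorted_list_of_set (snd ` P)) P"

definition add_up :: "point set \<Rightarrow> point set" where
  "add_up P = sweep_up P - P"

definition IRB_up :: "real list \<Rightarrow> nat" where
  "IRB_up X = card (add_up (G X))"

text \<open>The sets whose cardinalities enter the statement are finite, so \<open>card\<close> counts them.\<close>

lemma finite_G: "finite (G X)"
  unfolding G_def by simp

lemma finite_z_rectangles:
  assumes "finite P"
  shows "finite (z_rectangles P)"
  by (rule finite_subset[of _ "P \<times> P \<times> P \<times> P"])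
     (use assms in \<open>auto simp: z_rectangles_def z_rectangle_def\<close>)

lemma finite_add_up:
  assumes "finite P"
  shows "finite (add_up P)"
proof -
  have corners: "finite (corners_up Q p)" if "finite Q" for Q p
    by (rule finite_subset[of _ "(\<lambda>q. (fst q, snd p)) ` Q"])
       (use that in \<open>auto simp: corners_up_def intro: rev_image_eqI\<close>)
  have "finite (fold (sweep_up_at P) ys Q)" if "finite Q" for ys Q
    using that
    by (induction ys arbitrary: Q) (use assms corners in \<open>auto simp: sweep_up_at_def\<close>)
  then show ?thesis
    using assms by (simp add: add_up_def sweep_up_def)
qed

end

theory Submission
  imports Defs
begin

text \<open>
  Call a column \<open>x\<close> touched at \<open>p\<close> if the sweep adds a corner in column \<open>x\<close> when it reaches \<open>p\<close>.
  A column, once hidden by a point to its right, stays hidden behind that point; hence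
  a column touched at \<open>p\<close> has no point strictly between itself and \<open>p\<close> that is newer
  than its own input point, and two columns touched at the same time are never touched
  together again.

  Suppose that two columns touched at \<open>p\<close> had both received corners before. Let \<open>y\<close> be the left one
  of their input points, and \<open>s\<close> the horizontally closest input point to the right of \<open>p\<close> in the
  rows between \<open>y\<close> and \<open>p\<close>. If some input point below \<open>p\<close> lies horizontally between \<open>p\<close> and
  \<open>s\<close>, there is a z-rectangle with top point \<open>p\<close>; otherwise both columns were touched together
  at \<open>s\<close>, which is impossible. So, apart from the first corner of each column, every \<open>p\<close> that is
  not the top of a z-rectangle yields at most one corner, and \<open>c\<close> z-rectangles
  give at most \<open>(c + 2) m\<close> corners.
\<close>

section \<open>Visibility of columns from a sweep point\<close>

text \<open>Visibility is tested only against points strictly below \<open>p\<close>, so it may be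
  evaluated in the final set instead of the set present when \<open>p\<close> is reached.\<close>

definition touched :: "point set \<Rightarrow> point \<Rightarrow> real set" where
  "touched S p = {fst q | q. q \<in> S \<and> fst q < fst p \<and> snd q < snd p \<and>
     (\<forall>z\<in>S. snd z < snd p \<longrightarrow> z \<in> rect p q \<longrightarrow> z = q)}"

lemma touchedE:
  assumes "x \<in> touched S p"
  obtains t where "(x, t) \<in> S" "x < fst p" "t < snd p"
    "\<And>z. z \<in> S \<Longrightarrow> snd z < snd p \<Longrightarrow> x \<le> fst z \<Longrightarrow> fst z \<le> fst p \<Longrightarrow> t \<le> snd z \<Longrightarrow> z = (x, t)"
proof -
  obtain q where q: "q \<in> S" "fst q = x" "fst q < fst p" "snd q < snd p"
    "\<forall>z\<in>S. snd z < snd p \<longrightarrow> z \<in> rect p q \<longrightarrow> z = q"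
    using assms by (auto simp: touched_def)
  show thesis
  proof (rule that[of "snd q"])
    show "(x, snd q) \<in> S" using q by (metis prod.collapse)
    show "x < fst p" "snd q < snd p" using q by auto
    fix z assume z: "z \<in> S" "snd z < snd p" "x \<le> fst z" "fst z \<le> fst p" "snd q \<le> snd z"
    then have "z \<in> rect p q" using q by (cases z) (auto simp: rect_def)
    then show "z = (x, snd q)" using q z by (metis prod.collapse)
  qed
qed

lemma touchedI:
  assumes "(x, t) \<in> S" "x < fst p" "t < snd p"
    and "\<And>z. z \<in> S \<Longrightarrow> snd z < snd p \<Longrightarrow> x \<le> fst z \<Longrightarrow> fst z \<le> fst p \<Longrightarrow> t \<le> snd z \<Longrightarrow> z = (x, t)"
  shows "x \<in> touched S p"
proof -
  have "z = (x, t)" if "z \<in> S" "snd z < snd p" "z \<in> rect p (x, t)" for z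
    by (rule assms(4)) (use that assms(2,3) in \<open>auto simp: rect_def\<close>)
  then show ?thesis
    unfolding touched_def mem_Collect_eq using assms(1-3) by (intro exI[of _ "(x, t)"]) auto
qed

lemma touched_cong:
  assumes "\<And>z. snd z < snd p \<Longrightarrow> z \<in> S \<longleftrightarrow> z \<in> S'"
  shows "touched S p = touched S' p"
proof -
  have "touched A p \<subseteq> touched B p" if eq: "\<And>z. snd z < snd p \<Longrightarrow> z \<in> A \<longleftrightarrow> z \<in> B" for A B
  proof
    fix x assume "x \<in> touched A p"
    then show "x \<in> touched B p"
    proof (rule touchedE)
      fix t assume t: "(x, t) \<in> A" "x < fst p" "t < snd p"
        "\<And>z. z \<in> A \<Longrightarrow> snd z < snd p \<Longrightarrow> x \<le> fst z \<Longrightarrow> fst z \<le> fst p \<Longrightarrow> t \<le> snd z \<Longrightarrow> z = (x, t)"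
      show ?thesis
      proof (rule touchedI)
        show "(x, t) \<in> B" using eq[of "(x, t)"] t(1,3) by simp
        show "z = (x, t)" if "z \<in> B" "snd z < snd p" "x \<le> fst z" "fst z \<le> fst p" "t \<le> snd z" for z
          by (rule t(4)) (use that eq in auto)
      qed fact+
    qed
  qed
  then show ?thesis using assms by (intro equalityI) auto
qed

text \<open>The two visibility conditions differ only in whether the row of \<open>p\<close> is
  inspected, and there \<open>row\<close> leaves no point but \<open>p\<close>.\<close>

lemma corners_up_eq_touched:
  assumes "p \<in> Q" and row: "\<And>z. z \<in> Q \<Longrightarrow> snd z = snd p \<Longrightarrow> z = p"
  shows "corners_up Q p = (\<lambda>x. (x, snd p)) ` touched Q p"
proof -
  have *: "Q \<inter> rect p q = {p, q} \<longleftrightarrow> (\<forall>z\<in>Q. snd z < snd p \<longrightarrow> z \<in> rect p q \<longrightarrow> z = q)"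
    if q: "q \<in> Q" "snd q < snd p" for q
  proof -
    have pq: "p \<in> rect p q" "q \<in> rect p q"
      by (cases p; cases q; auto simp: rect_def)+
    have le: "snd z \<le> snd p" if "z \<in> rect p q" for z
      using that q by (auto simp: rect_def)
    show ?thesis
    proof
      assume "Q \<inter> rect p q = {p, q}"
      then have "z \<in> {p, q}" if "z \<in> Q" "z \<in> rect p q" for z using that by blast
      then show "\<forall>z\<in>Q. snd z < snd p \<longrightarrow> z \<in> rect p q \<longrightarrow> z = q" by auto
    next
      assume H: "\<forall>z\<in>Q. snd z < snd p \<longrightarrow> z \<in> rect p q \<longrightarrow> z = q"
      have "z = p \<or> z = q" if "z \<in> Q" "z \<in> rect p q" for z
        using le[OF that(2)] row[OF that(1)] H that by (cases "snd z = snd p") auto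
      then show "Q \<inter> rect p q = {p, q}" using pq q assms(1) by blast
    qed
  qed
  have "corners_up Q p = {(fst q, snd p) | q. q \<in> Q \<and> fst q < fst p \<and> snd q < snd p \<and>
      (\<forall>z\<in>Q. snd z < snd p \<longrightarrow> z \<in> rect p q \<longrightarrow> z = q)}"
    unfolding corners_up_def using * by (intro Collect_cong ex_cong1) metis
  then show ?thesis unfolding touched_def by (simp add: setcompr_eq_image image_image)
qed

section \<open>The sweep result as a fixed point\<close>

text \<open>The fold may occur on both sides because each step adds points only at its own height,
  and no touched set of that row or an earlier one looks that high.\<close>

lemma fold_sweep_up_at_eq:
  assumes inj: "inj_on snd P" and "sorted_wrt (<) ys" "set ys \<subseteq> snd ` P"
  shows "fold (sweep_up_at P) ys P = P \<union> (\<Union>p \<in> {p \<in> P. snd p \<in> set ys}.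
    (\<lambda>x. (x, snd p)) ` touched (fold (sweep_up_at P) ys P) p)"
  using assms(2,3)
proof (induction ys rule: rev_induct)
  case Nil
  then show ?case by simp
next
  case (snoc y ys)
  define R where "R = fold (sweep_up_at P) ys P"
  define R' where "R' = fold (sweep_up_at P) (ys @ [y]) P"
  have R: "R = P \<union> (\<Union>p \<in> {p \<in> P. snd p \<in> set ys}. (\<lambda>x. (x, snd p)) ` touched R p)"
    using snoc unfolding R_def by (simp add: sorted_wrt_append)
  have lt: "t < y" if "t \<in> set ys" for t
    using snoc.prems that by (simp add: sorted_wrt_append)
  obtain p where p: "p \<in> P" "snd p = y" using snoc.prems by auto
  have uniq: "{p \<in> P. snd p = y} = {p}" using p inj by (auto dest: inj_onD)
  have "corners_up R p = (\<lambda>x. (x, snd p)) ` touched R p"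
  proof (rule corners_up_eq_touched)
    show "p \<in> R" using R p by blast
    fix z assume z: "z \<in> R" "snd z = snd p"
    then have "z \<in> P \<or> snd z \<in> set ys" by (subst (asm) R) auto
    then show "z = p" using z p lt uniq by auto
  qed
  then have R': "R' = R \<union> (\<lambda>x. (x, y)) ` touched R p"
    by (simp add: R'_def R_def[symmetric] sweep_up_at_def uniq p)
  have T: "touched R' a = touched R a" if "snd a \<le> y" for a
    by (rule touched_cong) (use that R' in auto)
  have set': "{a \<in> P. snd a \<in> set (ys @ [y])} = insert p {a \<in> P. snd a \<in> set ys}"
    using uniq by auto
  have "R' = P \<union> (\<Union>a \<in> {a \<in> P. snd a \<in> set (ys @ [y])}. (\<lambda>x. (x, snd a)) ` touched R a)"
    unfolding set' R' by (subst R) (simp only: UN_insert p(2) Un_ac)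
  also have "\<dots> = P \<union> (\<Union>a \<in> {a \<in> P. snd a \<in> set (ys @ [y])}. (\<lambda>x. (x, snd a)) ` touched R' a)"
  proof -
    have "touched R a = touched R' a" if "snd a \<in> set (ys @ [y])" for a
      using T[of a] lt[of "snd a"] that by auto
    then show ?thesis by simp
  qed
  finally show ?case by (simp add: R'_def)
qed

lemma sweep_up_eq:
  assumes "finite P" "inj_on snd P"
  shows "sweep_up P = P \<union> (\<Union>p\<in>P. (\<lambda>x. (x, snd p)) ` touched (sweep_up P) p)"
proof -
  have "{p \<in> P. snd p \<in> set (sorted_list_of_set (snd ` P))} = P" using assms(1) by auto
  moreover have "sorted_wrt (<) (sorted_list_of_set (snd ` P))"
    by (simp add: strict_sorted_iff)
  moreover have "set (sorted_list_of_set (snd ` P)) \<subseteq> snd ` P" using assms(1) by simp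
  ultimately show ?thesis
    unfolding sweep_up_def using fold_sweep_up_at_eq[OF assms(2), of "sorted_list_of_set (snd ` P)"]
    by (simp only:)
qed

section \<open>Columns and the points hiding them\<close>

text \<open>The order of the sweep survives only in \<open>S_eq\<close>: \<open>touched S p\<close>
  reads the rows below \<open>p\<close>, so the equation can be unwound from bottom to top.\<close>

locale sweep =
  fixes P S :: "point set"
  assumes finite_P: "finite P"
    and inj_fst: "inj_on fst P"
    and inj_snd: "inj_on snd P"
    and S_eq: "S = P \<union> (\<Union>p\<in>P. (\<lambda>x. (x, snd p)) ` touched S p)"
begin

lemma P_subset_S: "P \<subseteq> S"
  by (subst S_eq) (rule Un_upper1)

lemma S_cases:
  assumes "z \<in> S"
  obtains "z \<in> P" | p where "p \<in> P" "snd p = snd z" "fst z \<in> touched S p"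
proof -
  have "z \<in> P \<union> (\<Union>p\<in>P. (\<lambda>x. (x, snd p)) ` touched S p)" using assms S_eq by (rule back_subst)
  then show thesis using that by auto
qed

lemma corner_in_S: "p \<in> P \<Longrightarrow> x \<in> touched S p \<Longrightarrow> (x, snd p) \<in> S"
  by (subst S_eq) (simp add: UnI2 rev_bexI)

text \<open>Stands in for induction on sweep time. Heights are reals, but every point of
  \<open>S\<close> shares its row with an input point, so the number of input points below serves as
  measure.\<close>

lemma row_induct [consumes 1, case_names row]:
  assumes "z \<in> S"
    and "\<And>z. z \<in> S \<Longrightarrow> (\<And>w. w \<in> S \<Longrightarrow> snd w < snd z \<Longrightarrow> K w) \<Longrightarrow> K z"
  shows "K z"
  using assms(1)
proof (induction "card {p \<in> P. snd p < snd z}" arbitrary: z rule: less_induct)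
  case less
  show ?case
  proof (rule assms(2)[OF less.prems])
    fix w assume w: "w \<in> S" "snd w < snd z"
    from w(1) obtain p where p: "p \<in> P" "snd p = snd w" by (cases rule: S_cases) auto
    have "{p \<in> P. snd p < snd w} \<subseteq> {p \<in> P. snd p < snd z}" using w by auto
    moreover have "p \<in> {p \<in> P. snd p < snd z} - {p \<in> P. snd p < snd w}" using p w by simp
    ultimately have "{p \<in> P. snd p < snd w} \<subset> {p \<in> P. snd p < snd z}" by blast
    then have "card {p \<in> P. snd p < snd w} < card {p \<in> P. snd p < snd z}"
      using finite_P by (intro psubset_card_mono) simp_all
    then show "K w" using less.hyps w(1) by blast
  qed
qed

text \<open>A corner lies above another point of \<open>S\<close> in its own column, and this
  descent can only end at an input point.\<close>

lemma origin:
  assumes "z \<in> S"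
  obtains o' where "o' \<in> P" "fst o' = fst z" "snd o' \<le> snd z"
proof -
  have "\<exists>a\<in>P. fst a = fst z \<and> snd a \<le> snd z"
    using assms
  proof (induction z rule: row_induct)
    case (row z)
    from row(1) show ?case
    proof (cases rule: S_cases)
      case 1
      then show ?thesis by blast
    next
      case (2 p)
      from 2(3) obtain t where "(fst z, t) \<in> S" "t < snd p" by (rule touchedE)
      then show ?thesis using row(2)[of "(fst z, t)"] 2 by force
    qed
  qed
  then show thesis using that by blast
qed

text \<open>Whenever a column is touched, the same row gains a point no further right than any
  point that was hiding the column: hidden columns stay hidden.\<close>

lemma hidden_persists:
  assumes "u \<in> S" "y \<in> P" "fst y = fst u" "w \<in> S" "fst u < fst w" "snd y \<le> snd w" "snd w \<le> snd u"
  shows "\<exists>z\<in>S. fst u < fst z \<and> fst z \<le> fst w \<and> snd z = snd u"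
  using assms
proof (induction u rule: row_induct)
  case (row u)
  show ?case
  proof (cases "snd w = snd u")
    case True
    then show ?thesis using row.prems by blast
  next
    case False
    then have lt: "snd w < snd u" using row.prems by simp
    from row(1) show ?thesis
    proof (cases rule: S_cases)
      case 1
      then have "u = y" using row.prems inj_fst by (auto dest: inj_onD)
      then show ?thesis using lt row.prems by simp
    next
      case (2 p)
      from 2(3) obtain t where t: "(fst u, t) \<in> S" "fst u < fst p" "t < snd p"
        "\<And>z. z \<in> S \<Longrightarrow> snd z < snd p \<Longrightarrow> fst u \<le> fst z \<Longrightarrow> fst z \<le> fst p \<Longrightarrow> t \<le> snd z \<Longrightarrow> z = (fst u, t)"
        by (rule touchedE) blast
      \<comment> \<open>Were \<open>p\<close> to the right of \<open>w\<close>, then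
        \<open>w\<close>, or the point in row \<open>t\<close> supplied by induction when
        \<open>w\<close> is not above that row, would obstruct the view from \<open>p\<close> to
        \<open>(fst u, t)\<close>. So \<open>p\<close> itself is the required point.\<close>
      have "fst p \<le> fst w"
      proof (cases "snd w \<le> t")
        case True
        then obtain z where z: "z \<in> S" "fst u < fst z" "fst z \<le> fst w" "snd z = t"
          using row(2)[of "(fst u, t)"] t(1-3) 2 row.prems by auto
        have "z \<noteq> (fst u, t)" using z(2) by (metis fst_conv less_irrefl)
        then have "fst p < fst z" using t(4)[OF z(1)] t(3) z by linarith
        then show ?thesis using z by simp
      next
        case False
        moreover have "w \<noteq> (fst u, t)" using row.prems(4) by (metis fst_conv less_irrefl)
        ultimately show ?thesis using t(4)[OF row.prems(3)] row.prems lt 2 by linarith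
      qed
      then show ?thesis using t(2) 2 P_subset_S by auto
    qed
  qed
qed

text \<open>A point \<open>w\<close> below \<open>p\<close> would hide the column. If
  \<open>w\<close> is not above the point seen from \<open>p\<close>, \<open>hidden_persists\<close>
  carries the obstruction up to the row of that point, inside the rectangle that has to be
  empty.\<close>

lemma touched_no_newer_between:
  assumes "x \<in> touched S p" "y \<in> P" "fst y = x" "w \<in> S" "x < fst w" "fst w \<le> fst p"
    "snd y \<le> snd w"
  shows "snd p \<le> snd w"
proof (rule ccontr)
  assume "\<not> snd p \<le> snd w"
  then have lt: "snd w < snd p" by simp
  from assms(1) obtain t where t: "(x, t) \<in> S" "x < fst p" "t < snd p"
    "\<And>z. z \<in> S \<Longrightarrow> snd z < snd p \<Longrightarrow> x \<le> fst z \<Longrightarrow> fst z \<le> fst p \<Longrightarrow> t \<le> snd z \<Longrightarrow> z = (x, t)"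
    by (rule touchedE) blast
  show False
  proof (cases "snd w \<le> t")
    case True
    then obtain z where z: "z \<in> S" "x < fst z" "fst z \<le> fst w" "snd z = t"
      using hidden_persists[OF t(1) assms(2) _ assms(4)] assms by auto
    have "z \<noteq> (x, t)" using z(2) by (metis fst_conv less_irrefl)
    then show False using t(4)[OF z(1)] t(3) z assms by linarith
  next
    case False
    moreover have "w \<noteq> (x, t)" using assms(5) by (metis fst_conv less_irrefl)
    ultimately show False using t(4)[OF assms(4)] lt assms by linarith
  qed
qed

text \<open>\<open>(x2, t)\<close> lies horizontally between column \<open>x1\<close> and
  \<open>p\<close>, and no lower than the input point of \<open>x1\<close>, because that column
  contains \<open>(x1, t)\<close>.\<close>

lemma touched_together_once:
  assumes "x1 \<in> touched S p" "x2 \<in> touched S p" "x1 < x2" "(x1, t) \<in> S" "(x2, t) \<in> S"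
  shows "snd p \<le> t"
proof -
  obtain y where "y \<in> P" "fst y = x1" "snd y \<le> t" using origin[OF assms(4)] by auto
  moreover have "x2 < fst p" using assms(2) by (rule touchedE)
  ultimately show ?thesis using touched_no_newer_between[OF assms(1), of y "(x2, t)"] assms by simp
qed

section \<open>Retouched columns and z-rectangles\<close>

text \<open>A column satisfies this at no more than one \<open>p\<close>, so over all
  \<open>p\<close> these sets account for at most \<open>card P\<close> corners; only the remaining
  touches need geometry.\<close>

definition first_touched :: "point \<Rightarrow> real set" where
  "first_touched p = {x \<in> touched S p. \<forall>t < snd p. (x, t) \<in> S \<longrightarrow> (x, t) \<in> P}"

lemma z_rectangle_if_point_between:
  assumes p: "p \<in> P" and x: "x \<in> touched S p" and y: "y \<in> P" "fst y = x" "snd y < snd p"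
    and s: "s \<in> P" "fst p < fst s" "snd y < snd s" "snd s < snd p"
    and s_min: "\<And>a. a \<in> P \<Longrightarrow> fst p < fst a \<Longrightarrow> snd y < snd a \<Longrightarrow> snd a < snd p \<Longrightarrow> fst s \<le> fst a"
    and b: "b \<in> P" "fst p < fst b" "fst b < fst s" "snd b < snd p"
  shows "\<exists>q r. z_rectangle P p q r s"
proof -
  have eq_fst: "a = a'" if "a \<in> P" "a' \<in> P" "fst a = fst a'" for a a'
    using that inj_fst by (auto dest: inj_onD)
  have eq_snd: "a = a'" if "a \<in> P" "a' \<in> P" "snd a = snd a'" for a a'
    using that inj_snd by (auto dest: inj_onD)
  have xp: "x < fst p" using x by (rule touchedE)
  \<comment> \<open>\<open>r\<close> will be the highest input point below \<open>p\<close> in the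
    vertical strip between \<open>p\<close> and \<open>s\<close>; \<open>b\<close> is a
    candidate.\<close>
  define A where "A = {a \<in> P. fst p < fst a \<and> fst a < fst s \<and> snd a < snd p}"
  have A: "finite A" "A \<noteq> {}" using b finite_P unfolding A_def by (simp, blast)
  obtain r where r: "r \<in> A" and r_max: "\<And>a. a \<in> A \<Longrightarrow> snd a \<le> snd r"
    using obtains_MAX[OF A, of snd] A(1) by (metis Max_ge finite_imageI imageI)
  \<comment> \<open>Otherwise \<open>r\<close> would lie in the rows between \<open>y\<close> and
    \<open>p\<close>, closer to \<open>p\<close> than \<open>s\<close>.\<close>
  have below: "snd r < snd y"
  proof (rule ccontr)
    assume "\<not> snd r < snd y"
    then have "snd y < snd r" using eq_snd[of r y] r y xp by (force simp: A_def)
    then show False using s_min[of r] r by (auto simp: A_def)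
  qed
  \<comment> \<open>\<open>q\<close> will be the rightmost input point to the left of
    \<open>p\<close> in the rows between \<open>r\<close> and \<open>p\<close>; \<open>y\<close> is
    a candidate.\<close>
  define B where "B = {a \<in> P. fst a < fst p \<and> snd r < snd a \<and> snd a < snd p}"
  have B: "finite B" "y \<in> B" using y xp below finite_P by (auto simp: B_def)
  obtain q where q: "q \<in> B" and q_max: "\<And>a. a \<in> B \<Longrightarrow> fst a \<le> fst q"
    using obtains_MAX[of B fst] B by (metis Max_ge empty_iff finite_imageI imageI)
  \<comment> \<open>If \<open>q\<close> is not \<open>y\<close>, it lies to the right of column
    \<open>x\<close>, so it must be older than \<open>y\<close>, which is itself below
    \<open>s\<close>.\<close>
  have qs: "snd q < snd s"
  proof (cases "q = y")
    case False
    then have "x < fst q" using q_max[OF B(2)] eq_fst[of q y] q y by (force simp: B_def)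
    then have "\<not> snd y \<le> snd q"
      using touched_no_newer_between[OF x y(1,2), of q] q P_subset_S by (auto simp: B_def)
    then show ?thesis using s by simp
  qed (use s in simp)
  have mem: "p \<in> P" "q \<in> P" "r \<in> P" "s \<in> P" and
    ineq: "fst q < fst p" "fst p < fst r" "fst r < fst s" "snd r < snd q"
    using p q r s by (auto simp: A_def B_def)
  have "a \<in> {p, q, r, s}"
    if a: "a \<in> P" "fst q \<le> fst a" "fst a \<le> fst s" "snd r \<le> snd a" "snd a \<le> snd p" for a
  proof -
    \<comment> \<open>Distinct coordinates settle the first four cases, the extremal choices of
      \<open>q\<close> and \<open>r\<close> the last two.\<close>
    consider "fst a = fst p" | "snd a = snd p" | "snd a = snd r" | "fst a = fst s"
      | "fst a < fst p" "snd r < snd a" "snd a < snd p"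
      | "fst p < fst a" "fst a < fst s" "snd r < snd a" "snd a < snd p"
      using a by linarith
    then show ?thesis
    proof cases
      case 5
      then have "fst a = fst q" using q_max[of a] a by (auto simp: B_def)
      then show ?thesis using eq_fst a mem by blast
    next
      case 6
      then show ?thesis using r_max[of a] a by (auto simp: A_def)
    qed (use a mem eq_fst eq_snd in blast)+
  qed
  then have "P \<inter> ({fst q..fst s} \<times> {snd r..snd p}) \<subseteq> {p, q, r, s}"
    by (intro subsetI) (simp add: mem_Times_iff)
  moreover have "{p, q, r, s} \<subseteq> P \<inter> ({fst q..fst s} \<times> {snd r..snd p})"
    using mem ineq qs s by (auto simp: mem_Times_iff)
  ultimately have "P \<inter> ({fst q..fst s} \<times> {snd r..snd p}) = {p, q, r, s}" by (rule equalityI)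
  then show ?thesis
    using mem ineq qs s unfolding z_rectangle_def by blast
qed

text \<open>The view from \<open>s\<close> is clear up to \<open>p\<close> by \<open>free\<close>,
  and from there to column \<open>x\<close> because nothing newer than \<open>y\<close> and below
  \<open>p\<close> lies there.\<close>

lemma touched_at_visible_point:
  assumes p: "p \<in> P" and x: "x \<in> touched S p" and y: "y \<in> P" "fst y = x"
    and s: "s \<in> P" "fst p < fst s" "snd y < snd s" "snd s < snd p"
    and free: "\<And>b. b \<in> P \<Longrightarrow> fst p < fst b \<Longrightarrow> fst b < fst s \<Longrightarrow> snd p \<le> snd b"
  shows "x \<in> touched S s"
proof -
  have xp: "x < fst p" using x by (rule touchedE)
  \<comment> \<open>\<open>Max A\<close> is the height of the topmost point of column
    \<open>x\<close> below \<open>s\<close>, the one that \<open>s\<close> sees.\<close>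
  define A where "A = {t \<in> snd ` P. (x, t) \<in> S \<and> t < snd s}"
  have "snd y \<in> A" using y s P_subset_S by (auto simp: A_def)
  moreover have "finite A" using finite_P by (simp add: A_def)
  ultimately have tA: "Max A \<in> A" and t_max: "\<And>t. t \<in> A \<Longrightarrow> t \<le> Max A" by (auto intro: Max_in)
  have yt: "snd y \<le> Max A" using t_max \<open>snd y \<in> A\<close> by blast
  show ?thesis
  proof (rule touchedI[of _ "Max A"])
    show "(x, Max A) \<in> S" "Max A < snd s" using tA by (auto simp: A_def)
    show "x < fst s" using xp s by simp
    fix z assume z: "z \<in> S" "snd z < snd s" "x \<le> fst z" "fst z \<le> fst s" "Max A \<le> snd z"
    \<comment> \<open>No point of \<open>S\<close> lies below the input point of its column, so
      \<open>free\<close>, stated for input points, also excludes corners in the strip.\<close>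
    obtain a where a: "a \<in> P" "fst a = fst z" "snd a \<le> snd z" using origin[OF z(1)] by blast
    have "snd z \<in> snd ` P" using z(1) by (cases rule: S_cases) (metis image_eqI)+
    consider "fst z = x" | "x < fst z" "fst z \<le> fst p" | "fst p < fst z" "fst z < fst s" | "fst z = fst s"
      using z by linarith
    then show "z = (x, Max A)"
    proof cases
      case 1
      then have "snd z \<in> A" using z \<open>snd z \<in> snd ` P\<close> by (cases z) (auto simp: A_def)
      then show ?thesis using t_max[of "snd z"] z 1 by (cases z) auto
    next
      case 2
      then show ?thesis using touched_no_newer_between[OF x y, of z] z yt s by auto
    next
      case 3
      then show ?thesis using free[of a] a z s by auto
    next
      case 4
      then have "a = s" using a s inj_fst by (auto dest: inj_onD)
      then show ?thesis using a z by simp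
    qed
  qed
qed

lemma retouched_unique:
  assumes p: "p \<in> P" and no_z: "\<nexists>q r s. z_rectangle P p q r s"
    and x1: "x1 \<in> touched S p - first_touched p" and x2: "x2 \<in> touched S p - first_touched p"
    and "x1 < x2"
  shows False
proof -
  have T: "x1 \<in> touched S p" "x2 \<in> touched S p" using x1 x2 by auto
  have x2p: "x2 < fst p" using T(2) by (rule touchedE)
  obtain t1 where t1: "t1 < snd p" "(x1, t1) \<in> S" "(x1, t1) \<notin> P"
    using x1 by (auto simp: first_touched_def)
  obtain t2 where t2: "(x2, t2) \<in> S" using T(2) by (rule touchedE)
  obtain y1 where y1: "y1 \<in> P" "fst y1 = x1" "snd y1 \<le> t1" using origin[OF t1(2)] by auto
  obtain y2 where y2: "y2 \<in> P" "fst y2 = x2" using origin[OF t2] by (metis fst_conv)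
  have "\<not> snd y2 \<ge> snd p"
    using T(2)
  proof (rule touchedE)
    fix t assume t: "(x2, t) \<in> S" "t < snd p"
    obtain a where "a \<in> P" "fst a = x2" "snd a \<le> t" using origin[OF t(1)] by auto
    then show ?thesis using t y2 inj_fst by (metis inj_onD not_le order_le_less_trans)
  qed
  \<comment> \<open>A higher \<open>y2\<close> would be a newer point between column
    \<open>x1\<close> and \<open>p\<close>. Hence \<open>s\<close>, chosen above \<open>y1\<close>,
    is also above \<open>y2\<close>.\<close>
  then have y21: "snd y2 < snd y1"
    using touched_no_newer_between[OF T(1) y1(1,2), of y2] y2 P_subset_S x2p \<open>x1 < x2\<close> by force
  \<comment> \<open>The earlier corner of \<open>x1\<close> was created at some \<open>a\<close>. To
    the left of \<open>p\<close>, \<open>a\<close> would be a newer point in between; so it lies to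
    the right and is a candidate for \<open>s\<close>.\<close>
  from t1(2) obtain a where a: "a \<in> P" "snd a = t1" "x1 \<in> touched S a"
    using t1(3) by (cases rule: S_cases) auto
  have "x1 < fst a" using a(3) by (rule touchedE)
  then have pa: "fst p < fst a"
    using touched_no_newer_between[OF T(1) y1(1,2), of a] a y1 t1 P_subset_S by force
  have "t1 \<noteq> snd y1" using t1 y1 by (metis prod.collapse)
  define A where "A = {a \<in> P. fst p < fst a \<and> snd y1 < snd a \<and> snd a < snd p}"
  have A: "finite A" "a \<in> A"
    using finite_P a pa y1 t1 \<open>t1 \<noteq> snd y1\<close> by (auto simp: A_def)
  obtain s where "s \<in> A" and s_min: "\<And>b. b \<in> A \<Longrightarrow> fst s \<le> fst b"
    using obtains_MIN[of A fst] A by (metis Min_le empty_iff finite_imageI imageI)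
  then have s: "s \<in> P" "fst p < fst s" "snd y1 < snd s" "snd s < snd p" by (auto simp: A_def)
  have free: "snd p \<le> snd b" if "b \<in> P" "fst p < fst b" "fst b < fst s" for b
  proof (rule ccontr)
    assume "\<not> snd p \<le> snd b"
    then have "\<exists>q r. z_rectangle P p q r s"
      by (intro z_rectangle_if_point_between[OF p T(1) y1(1,2) _ s _ that(1)])
        (use s s_min that in \<open>auto simp: A_def\<close>)
    then show False using no_z by blast
  qed
  have "x1 \<in> touched S s"
    by (rule touched_at_visible_point[OF p T(1) y1(1,2) s free])
  moreover have "x2 \<in> touched S s"
    by (rule touched_at_visible_point[OF p T(2) y2 s(1,2) _ s(4) free]) (use y21 s in auto)
  ultimately have "snd p \<le> snd s"
    using touched_together_once[OF T \<open>x1 < x2\<close>] corner_in_S[OF s(1)] by blast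
  then show False using s by simp
qed

section \<open>Counting the added points\<close>

lemma touched_subset: "touched S p \<subseteq> fst ` P"
proof
  fix x assume "x \<in> touched S p"
  then obtain t where "(x, t) \<in> S" by (rule touchedE)
  then show "x \<in> fst ` P" by (rule origin) (metis fst_conv image_eqI)
qed

lemma finite_touched: "finite (touched S p)"
  by (rule finite_surj[OF finite_P touched_subset])

lemma card_touched_le: "card (touched S p) \<le> card P"
  by (rule surj_card_le[OF finite_P touched_subset])

lemma first_touched_subset: "first_touched p \<subseteq> touched S p"
  by (auto simp: first_touched_def)

lemma card_retouched_le:
  assumes "p \<in> P" "\<nexists>q r s. z_rectangle P p q r s"
  shows "card (touched S p - first_touched p) \<le> 1"
proof -
  have "x = x'" if "x \<in> touched S p - first_touched p" "x' \<in> touched S p - first_touched p" for x x'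
  proof (rule linorder_cases[of x x'])
    show "x = x'" if "x < x'"
      using retouched_unique[OF assms _ _ that] \<open>x \<in> _\<close> \<open>x' \<in> _\<close> by blast
    show "x = x'" if "x' < x"
      using retouched_unique[OF assms _ _ that] \<open>x \<in> _\<close> \<open>x' \<in> _\<close> by blast
  qed
  then show ?thesis by (simp add: card_le_Suc0_iff_eq finite_touched)
qed

text \<open>For a common column, the corner added at \<open>p\<close> lies below \<open>p'\<close>
  and would have to be an input point. In that row the only one is \<open>p\<close>, which is not in
  a column to its own left.\<close>

lemma first_touched_disjoint:
  assumes "p \<in> P" "p' \<in> P" "snd p < snd p'"
  shows "first_touched p \<inter> first_touched p' = {}"
proof (rule equals0I)
  fix x assume x: "x \<in> first_touched p \<inter> first_touched p'"
  then have xT: "x \<in> touched S p" by (auto simp: first_touched_def)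
  have "(x, snd p) \<in> P"
    using corner_in_S[OF assms(1) xT] x assms(3) by (auto simp: first_touched_def)
  then have "(x, snd p) = p" using inj_onD[OF inj_snd _ _ assms(1)] by (metis snd_conv)
  moreover have "x < fst p" using xT by (rule touchedE)
  ultimately show False by (metis fst_conv less_irrefl)
qed

lemma sum_card_first_touched_le: "(\<Sum>p\<in>P. card (first_touched p)) \<le> card P"
proof -
  have fin: "finite (first_touched p)" for p
    by (rule finite_subset[OF first_touched_subset finite_touched])
  have "first_touched p \<inter> first_touched p' = {}" if "p \<in> P" "p' \<in> P" "p \<noteq> p'" for p p'
  proof -
    have "snd p \<noteq> snd p'" using that inj_snd by (auto dest: inj_onD)
    then consider "snd p < snd p'" | "snd p' < snd p" by linarith
    then show ?thesis
      by cases (use first_touched_disjoint that in blast)+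
  qed
  then have "(\<Sum>p\<in>P. card (first_touched p)) = card (\<Union>p\<in>P. first_touched p)"
    using fin finite_P by (subst card_UN_disjoint) auto
  also have "\<dots> \<le> card P"
    by (rule surj_card_le[OF finite_P, of _ fst]) (use first_touched_subset touched_subset in blast)
  finally show ?thesis .
qed

text \<open>The summand 2 pays for the first corner of each column and for one further corner at
  each \<open>p\<close>. Only tops of z-rectangles, collected in \<open>B\<close>, may exceed this,
  and each touches at most \<open>card P\<close> columns.\<close>

theorem card_added_le: "card (S - P) \<le> (card (z_rectangles P) + 2) * card P"
proof -
  define B where "B = {p \<in> P. \<exists>q r s. z_rectangle P p q r s}"
  have B: "B \<subseteq> P" "finite B" using finite_P by (auto simp: B_def)
  have "B \<subseteq> fst ` z_rectangles P" unfolding B_def z_rectangles_def by force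
  then have card_B: "card B \<le> card (z_rectangles P)"
    by (rule surj_card_le[OF finite_z_rectangles[OF finite_P]])
  have fin: "finite (\<Union>p\<in>P. (\<lambda>x. (x, snd p)) ` touched S p)"
    using finite_P finite_touched by blast
  have "S - P \<subseteq> (\<Union>p\<in>P. (\<lambda>x. (x, snd p)) ` touched S p)" using S_eq by blast
  then have "card (S - P) \<le> card (\<Union>p\<in>P. (\<lambda>x. (x, snd p)) ` touched S p)"
    by (rule card_mono[OF fin])
  also have "\<dots> \<le> (\<Sum>p\<in>P. card ((\<lambda>x. (x, snd p)) ` touched S p))"
    by (rule card_UN_le[OF finite_P])
  also have "\<dots> \<le> (\<Sum>p\<in>P. card (touched S p))"
    by (intro sum_mono card_image_le finite_touched)
  also have "\<dots> \<le> (\<Sum>p\<in>P. card (first_touched p) + 1 + (if p \<in> B then card P else 0))"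
  proof (rule sum_mono)
    fix p assume p: "p \<in> P"
    show "card (touched S p) \<le> card (first_touched p) + 1 + (if p \<in> B then card P else 0)"
    proof (cases "p \<in> B")
      case True
      then show ?thesis using card_touched_le[of p] by simp
    next
      case False
      then have "card (touched S p - first_touched p) \<le> 1"
        using card_retouched_le p by (auto simp: B_def)
      then show ?thesis
        using card_Diff_subset[OF finite_subset[OF first_touched_subset finite_touched] first_touched_subset]
          False by simp
    qed
  qed
  also have "\<dots> = (\<Sum>p\<in>P. card (first_touched p)) + card P + card B * card P"
    unfolding sum.distrib using B finite_P by (simp add: sum.If_cases Int_absorb1)
  also have "\<dots> \<le> card P + card P + card (z_rectangles P) * card P"
    using sum_card_first_touched_le card_B by (intro add_mono mult_right_mono) auto
  finally show ?thesis by (simp add: algebra_simps)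
qed

end

section \<open>Transfer to access sequences\<close>

lemma inj_on_snd_G: "inj_on snd (G X)"
  by (auto simp: G_def inj_on_def)

lemma inj_on_fst_G: "distinct X \<Longrightarrow> inj_on fst (G X)"
  by (auto simp: G_def inj_on_def nth_eq_iff_index_eq)

lemma card_G: "card (G X) = length X"
proof -
  have "G X = (\<lambda>i. (X ! i, real (i + 1))) ` {..<length X}" by (auto simp: G_def)
  moreover have "inj_on (\<lambda>i. (X ! i, real (i + 1))) {..<length X}" by (auto simp: inj_on_def)
  ultimately show ?thesis by (simp add: card_image)
qed

theorem theorem3:
  shows "\<forall>c::real. c \<ge> 0 \<longrightarrow>
    (\<exists>C::real. \<forall>X::real list.
       distinct X \<longrightarrow> real (card (z_rectangles (G X))) \<le> c \<longrightarrow>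
       real (IRB_up X) \<le> C * real (length X))"
proof (intro allI impI)
  fix c :: real
  show "\<exists>C::real. \<forall>X::real list.
       distinct X \<longrightarrow> real (card (z_rectangles (G X))) \<le> c \<longrightarrow>
       real (IRB_up X) \<le> C * real (length X)"
  proof (intro exI[of _ "c + 2"] allI impI)
    fix X :: "real list"
    assume X: "distinct X" "real (card (z_rectangles (G X))) \<le> c"
    interpret sweep "G X" "sweep_up (G X)"
      by (rule sweep.intro[OF finite_G inj_on_fst_G[OF X(1)] inj_on_snd_G
            sweep_up_eq[OF finite_G inj_on_snd_G]])
    have "real (IRB_up X) \<le> real ((card (z_rectangles (G X)) + 2) * length X)"
      using card_added_le unfolding IRB_up_def add_up_def card_G of_nat_le_iff .
    also have "\<dots> \<le> (c + 2) * real (length X)"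
      unfolding of_nat_mult using X(2) by (intro mult_right_mono) simp_all
    finally show "real (IRB_up X) \<le> (c + 2) * real (length X)" .
  qed
qed

end
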